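(* Let $\gamma:S^1\rightarrow\mathbb{R}^2$ be a Jordan curve with at least two special corners. Let $p$ and $q$ be distinct special corners of $\gamma$, and suppose that the line passing through $p$ and $q$ is a line of angle $\theta_0$ for some $\theta_0\in\mathbb{R}$. Then there exists $\epsilon>0$ such that for all $\theta\in(\theta_0-\epsilon,\theta_0+\epsilon)$, there exists an inscribed rhombus of $\gamma$ of angle $\theta$.
   Context: A Jordan curve is a continuous injective map $\gamma:S^1\to\mathbb{R}^2$; no regularity is assumed. Its image is denoted $\operatorname{im}(\gamma)$. A line of angle $\theta$ ($\theta\in\mathbb{R}$) is a line in $\mathbb{R}^2$ of the form $x\sin\theta-y\cos\theta=\text{constant}$, i.e. a line making angle $\theta$ with the $x$-axis in the anti-clockwise sense. A special corner of $\gamma$ of angle $\theta$ is a point $p\in \operatorname{im}(\gamma)$ such that both the line of angle $\theta$ through $p$ and the line of angle $\theta+\frac{\pi}{2}$ through $p$ intersect $\operatorname{im}(\gamma)$ only at $p$. A point $p$ is a special corner of $\gamma$ if it is a special corner of $\gamma$ of at least one angle $\theta$. A rhombus of angle $\theta$ is a rhombus in $\mathbb{R}^2$ whose two diagonals lie on lines of angles $\theta$ and $\theta+\frac{\pi}{2}$ respectively (so "angle $\theta$" and "angle $\theta+\frac{\pi}{2}$" are the same concept for rhombi). An inscribed rhombus of $\gamma$ is a set of 4 distinct points in $\operatorname{im}(\gamma)$ which are the vertices of a rhombus in $\mathbb{R}^2$; it is an inscribed rhombus of angle $\theta$ if that rhombus is a rhombus of angle $\theta$. *)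

theory Defs
  imports "HOL-Analysis.Analysis"
begin

text \<open>The circle is the unit circle of the complex plane; a curve is a function on all of
  \<^typ>\<open>complex\<close>, of which only the values on the unit circle matter.\<close>

definition jordan_curve :: "(complex \<Rightarrow> real^2) \<Rightarrow> bool" where
  "jordan_curve \<gamma> \<longleftrightarrow> continuous_on (sphere 0 1) \<gamma> \<and> inj_on \<gamma> (sphere 0 1)"

definition curve_image :: "(complex \<Rightarrow> real^2) \<Rightarrow> (real^2) set" where
  "curve_image \<gamma> = \<gamma> ` sphere 0 1"

definition line_of_angle :: "real \<Rightarrow> (real^2) set \<Rightarrow> bool" where
  "line_of_angle \<theta> L \<longleftrightarrow> (\<exists>c. L = {v. v $ 1 * sin \<theta> - v $ 2 * cos \<theta> = c})"

text \<open>For each angle exactly one line of that angle passes through a given point, so the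
  universal quantifiers below range over \<^emph>\<open>the\<close> line of that angle through \<open>p\<close>.\<close>

definition special_corner_of_angle :: "(complex \<Rightarrow> real^2) \<Rightarrow> real \<Rightarrow> real^2 \<Rightarrow> bool" where
  "special_corner_of_angle \<gamma> \<theta> p \<longleftrightarrow>
     p \<in> curve_image \<gamma> \<and>
     (\<forall>L. line_of_angle \<theta> L \<and> p \<in> L \<longrightarrow> L \<inter> curve_image \<gamma> = {p}) \<and>
     (\<forall>L. line_of_angle (\<theta> + pi / 2) L \<and> p \<in> L \<longrightarrow> L \<inter> curve_image \<gamma> = {p})"

definition special_corner :: "(complex \<Rightarrow> real^2) \<Rightarrow> real^2 \<Rightarrow> bool" where
  "special_corner \<gamma> p \<longleftrightarrow> (\<exists>\<theta>. special_corner_of_angle \<gamma> \<theta> p)"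

text \<open>The vertices are listed in cyclic order, so the diagonals are \<open>ac\<close> and \<open>bd\<close>. In the plane
  four distinct points with equal consecutive distances form a non-degenerate rhombus.\<close>

definition rhombus :: "real^2 \<Rightarrow> real^2 \<Rightarrow> real^2 \<Rightarrow> real^2 \<Rightarrow> bool" where
  "rhombus a b c d \<longleftrightarrow>
     distinct [a, b, c, d] \<and> dist a b = dist b c \<and> dist b c = dist c d \<and> dist c d = dist d a"

definition rhombus_of_angle :: "real \<Rightarrow> real^2 \<Rightarrow> real^2 \<Rightarrow> real^2 \<Rightarrow> real^2 \<Rightarrow> bool" where
  "rhombus_of_angle \<theta> a b c d \<longleftrightarrow>
     rhombus a b c d \<and>
     (\<exists>L M. line_of_angle \<theta> L \<and> line_of_angle (\<theta> + pi / 2) M \<and>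
        (closed_segment a c \<subseteq> L \<and> closed_segment b d \<subseteq> M \<or>
         closed_segment b d \<subseteq> L \<and> closed_segment a c \<subseteq> M))"

definition inscribed_rhombus_of_angle :: "(complex \<Rightarrow> real^2) \<Rightarrow> real \<Rightarrow> (real^2) set \<Rightarrow> bool" where
  "inscribed_rhombus_of_angle \<gamma> \<theta> S \<longleftrightarrow>
     S \<subseteq> curve_image \<gamma> \<and> (\<exists>a b c d. S = {a, b, c, d} \<and> rhombus_of_angle \<theta> a b c d)"

end

theory Submission
  imports Defs
begin

text \<open>Turn the plane so that the line \<open>pq\<close> becomes horizontal, and say that \<open>p\<close> lies to the left.

  \<^bold>\<open>Why the corners matter.\<close> The curve without \<open>p\<close> is connected and avoids two perpendicular lines
  through \<open>p\<close>, so it lies in one open quadrant at \<open>p\<close>. That quadrant contains the direction of \<open>q\<close>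
  in its interior, and all directions in a quadrant make acute angles with each other. Hence \<open>p\<close> is
  the unique leftmost point of the curve, and \<open>q\<close> likewise is the unique rightmost one, in every
  frame of an angle close to \<open>\<theta>\<^sub>0\<close>
  (\<open>special_corner_strict_extreme\<close>).

  \<^bold>\<open>Chords.\<close> A rhombus of angle \<open>\<theta>\<close> is a horizontal and a vertical chord with a common midpoint.
  The curve consists of two arcs \<open>A\<close>, \<open>B\<close> from the leftmost to the rightmost point; the midpoints of
  vertical chords from \<open>A\<close> to \<open>B\<close> run from the left side to the right side of a rectangle around
  the curve. If \<open>C\<close>, \<open>E\<close> are two arcs from the bottom to the top of the rectangle, then the midpoints
  of horizontal chords from \<open>C\<close> to \<open>E\<close> run from bottom to top, and the two families have to meet.
  In place of the possibly wild families of midpoints, \<open>crossing_chords\<close> treats the four parameters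
  at once: the four scalar equations have a solution by the Poincare-Miranda theorem.

  \<^bold>\<open>Degeneration.\<close> The chords found may be degenerate. To exclude this, choose \<open>C\<close>, \<open>E\<close> at the angle
  \<open>\<theta>\<^sub>0\<close> as arcs of the curve from minimal to maximal height, meeting only at points of extreme height
  and not meeting at \<open>p\<close> or \<open>q\<close> (\<open>level_paths\<close>). Both corners have the same height at \<open>\<theta>\<^sub>0\<close>, so if that
  height is maximal, \<open>C\<close> and \<open>E\<close> can be let end at \<open>p\<close> and \<open>q\<close> respectively instead of at a common
  point; if it is minimal, they can start there. For \<open>\<theta>\<close> near \<open>\<theta>\<^sub>0\<close> the ends of \<open>C\<close>, \<open>E\<close> need no
  longer have extreme height; prolong them by vertical segments up to a common level above the
  curve and down to a common level below it. At \<open>\<theta>\<^sub>0\<close> a crossing is never degenerate and never uses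
  these segments: otherwise its midpoint would not lie strictly between the extreme heights, or
  else the vertical chord would already be a point; either way both ends of the vertical chord
  coincide, at \<open>p\<close> or \<open>q\<close>, and since these points are strictly extreme, \<open>C\<close> and \<open>E\<close> would meet there.
  The degenerate crossings of all angles form a closed set, and their parameters range over a
  compact one, so the angles at which they occur form a closed set; it does not contain \<open>\<theta>\<^sub>0\<close>
  (\<open>crossing_chords_stable\<close>).\<close>

section \<open>Coordinates in a rotated frame\<close>

definition along :: "real \<Rightarrow> real^2 \<Rightarrow> real" where
  "along \<theta> v = v $ 1 * cos \<theta> + v $ 2 * sin \<theta>"

definition across :: "real \<Rightarrow> real^2 \<Rightarrow> real" where
  "across \<theta> v = v $ 2 * cos \<theta> - v $ 1 * sin \<theta>"

lemma along_add: "along \<theta> (v + w) = along \<theta> v + along \<theta> w"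
  by (simp add: along_def algebra_simps)

lemma across_add: "across \<theta> (v + w) = across \<theta> v + across \<theta> w"
  by (simp add: across_def algebra_simps)

lemma frame_change:
  "along \<theta> v = cos (\<theta> - \<alpha>) * along \<alpha> v + sin (\<theta> - \<alpha>) * across \<alpha> v"
  "across \<theta> v = cos (\<theta> - \<alpha>) * across \<alpha> v - sin (\<theta> - \<alpha>) * along \<alpha> v"
proof -
  have *: "cos \<theta> = cos (\<theta> - \<alpha>) * cos \<alpha> - sin (\<theta> - \<alpha>) * sin \<alpha>"
          "sin \<theta> = sin (\<theta> - \<alpha>) * cos \<alpha> + cos (\<theta> - \<alpha>) * sin \<alpha>"
    using cos_add[of "\<theta> - \<alpha>" \<alpha>] sin_add[of "\<theta> - \<alpha>" \<alpha>] by simp_all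
  show "along \<theta> v = cos (\<theta> - \<alpha>) * along \<alpha> v + sin (\<theta> - \<alpha>) * across \<alpha> v"
       "across \<theta> v = cos (\<theta> - \<alpha>) * across \<alpha> v - sin (\<theta> - \<alpha>) * along \<alpha> v"
    unfolding along_def across_def *(1) *(2) by (simp_all add: algebra_simps)
qed

lemma norm_frame: "(norm v)\<^sup>2 = (along \<theta> v)\<^sup>2 + (across \<theta> v)\<^sup>2"
proof -
  have "(x * c + y * s)\<^sup>2 + (y * c - x * s)\<^sup>2 = (x\<^sup>2 + y\<^sup>2) * (s\<^sup>2 + c\<^sup>2)" for x y c s :: real
    by algebra
  then have "(along \<theta> v)\<^sup>2 + (across \<theta> v)\<^sup>2 = ((v $ 1)\<^sup>2 + (v $ 2)\<^sup>2) * ((sin \<theta>)\<^sup>2 + (cos \<theta>)\<^sup>2)"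
    unfolding along_def across_def .
  also have "\<dots> = (norm v)\<^sup>2"
    by (simp add: norm_vec_def L2_set_def sum_2)
  finally show ?thesis by simp
qed

lemma frame_eqI:
  assumes "along \<theta> v = along \<theta> w" "across \<theta> v = across \<theta> w"
  shows "v = w"
proof -
  have "along \<theta> (v - w) = 0" "across \<theta> (v - w) = 0"
    using assms by (auto simp: along_def across_def algebra_simps)
  then have "(norm (v - w))\<^sup>2 = 0"
    using norm_frame[of "v - w" \<theta>] by simp
  then show ?thesis by simp
qed

lemma abs_across_le_norm: "\<bar>across \<theta> v\<bar> \<le> norm v"
  using norm_frame[of v \<theta>] abs_le_square_iff[of "across \<theta> v" "norm v"] by simp

lemma continuous_on_frame [continuous_intros]:
  fixes f :: "'a::t2_space \<Rightarrow> real"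
  assumes "continuous_on S f" "continuous_on S g"
  shows "continuous_on S (\<lambda>x. along (f x) (g x))" "continuous_on S (\<lambda>x. across (f x) (g x))"
  unfolding along_def across_def by (intro continuous_intros assms)+

lemma line_of_angle_across: "line_of_angle \<theta> L \<longleftrightarrow> (\<exists>c. L = {v. across \<theta> v = c})"
proof -
  have eq: "{v. v $ 1 * sin \<theta> - v $ 2 * cos \<theta> = c} = {v. across \<theta> v = - c}" for c
    unfolding across_def by auto
  show ?thesis
    unfolding line_of_angle_def eq by (metis minus_minus)
qed

lemma line_of_angle_along: "line_of_angle (\<theta> + pi / 2) L \<longleftrightarrow> (\<exists>c. L = {v. along \<theta> v = c})"
  unfolding line_of_angle_def along_def by (simp add: sin_add cos_add)

text \<open>The chords \<open>ac\<close> and \<open>bd\<close> bisect each other at right angles, so each side is the hypotenuse of a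
  right triangle whose legs are half of each chord.\<close>

lemma rhombus_of_angle_crossing_chords:
  assumes "a \<noteq> c" "b \<noteq> d"
    and horizontal: "across \<theta> a = across \<theta> c" and vertical: "along \<theta> b = along \<theta> d"
    and midpoint: "a + c = b + d"
  shows "rhombus_of_angle \<theta> a b c d"
proof -
  have x: "along \<theta> a + along \<theta> c = 2 * along \<theta> b"
    and y: "across \<theta> b + across \<theta> d = 2 * across \<theta> a"
    using along_add[of \<theta> a c] along_add[of \<theta> b d] across_add[of \<theta> a c] across_add[of \<theta> b d]
      midpoint horizontal vertical by auto
  have nx: "along \<theta> a \<noteq> along \<theta> c" and ny: "across \<theta> b \<noteq> across \<theta> d"
    using assms(1,2) horizontal vertical frame_eqI by blast+
  have neq: "v \<noteq> w" if "v \<in> {a, c}" "w \<in> {b, d}" for v w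
    using that nx ny x y horizontal vertical by auto
  have sq: "(norm (v - w))\<^sup>2 = (along \<theta> a - along \<theta> b)\<^sup>2 + (across \<theta> b - across \<theta> a)\<^sup>2"
    if "v \<in> {a, c}" "w \<in> {b, d}" for v w
  proof -
    have "along \<theta> v - along \<theta> w = along \<theta> a - along \<theta> b
        \<or> along \<theta> v - along \<theta> w = - (along \<theta> a - along \<theta> b)"
      using that x vertical by auto
    moreover have "across \<theta> v - across \<theta> w = across \<theta> b - across \<theta> a
        \<or> across \<theta> v - across \<theta> w = - (across \<theta> b - across \<theta> a)"
      using that y horizontal by auto
    moreover have "along \<theta> (v - w) = along \<theta> v - along \<theta> w"
      "across \<theta> (v - w) = across \<theta> v - across \<theta> w"
      by (simp_all add: along_def across_def algebra_simps)
    ultimately show ?thesis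
      unfolding norm_frame[of "v - w" \<theta>] by (metis power2_minus)
  qed
  have sides: "dist v w = dist a b" "dist w v = dist a b"
    if "v \<in> {a, c}" "w \<in> {b, d}" for v w
  proof -
    have "(norm (v - w))\<^sup>2 = (norm (a - b))\<^sup>2"
      unfolding sq[OF that] sq[OF insertI1 insertI1] ..
    then show "dist v w = dist a b"
      unfolding dist_norm by (rule power2_eq_imp_eq) (rule norm_ge_zero)+
    then show "dist w v = dist a b"
      by (metis dist_commute)
  qed
  have "rhombus a b c d"
    unfolding rhombus_def
    using assms(1,2) neq[of a b] neq[of a d] neq[of c b] neq[of c d]
      sides(2)[of c b] sides(1)[of c d] sides(2)[of a d]
    by simp
  moreover have "closed_segment a c \<subseteq> {v. across \<theta> v = across \<theta> a}"
  proof
    fix v assume "v \<in> closed_segment a c"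
    then obtain k where v: "v = (1 - k) *\<^sub>R a + k *\<^sub>R c"
      by (auto simp: closed_segment_def)
    have "across \<theta> v = (1 - k) * across \<theta> a + k * across \<theta> c"
      unfolding v by (simp add: across_def algebra_simps)
    then show "v \<in> {v. across \<theta> v = across \<theta> a}"
      using horizontal by (simp add: algebra_simps)
  qed
  moreover have "closed_segment b d \<subseteq> {v. along \<theta> v = along \<theta> b}"
  proof
    fix v assume "v \<in> closed_segment b d"
    then obtain k where v: "v = (1 - k) *\<^sub>R b + k *\<^sub>R d"
      by (auto simp: closed_segment_def)
    have "along \<theta> v = (1 - k) * along \<theta> b + k * along \<theta> d"
      unfolding v by (simp add: along_def algebra_simps)
    then show "v \<in> {v. along \<theta> v = along \<theta> b}"
      using vertical by (simp add: algebra_simps)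
  qed
  moreover have "line_of_angle \<theta> {v. across \<theta> v = across \<theta> a}"
    unfolding line_of_angle_across by (rule exI, rule refl)
  moreover have "line_of_angle (\<theta> + pi / 2) {v. along \<theta> v = along \<theta> b}"
    unfolding line_of_angle_along by (rule exI, rule refl)
  ultimately show ?thesis
    unfolding rhombus_of_angle_def by iprover
qed

section \<open>Two families of chords with crossing midpoints\<close>

text \<open>If \<open>x - F x\<close> is pushed back into the box coordinatewise, a fixed point of the resulting map
  can differ from a zero of \<open>F\<close> only in a coordinate that is pushed back onto a face, and there the
  sign condition forbids it.\<close>

lemma poincare_miranda:
  fixes F :: "'a::euclidean_space \<Rightarrow> 'a"
  assumes cont: "continuous_on (cbox a b) F"
    and box: "\<And>i. i \<in> Basis \<Longrightarrow> a \<bullet> i \<le> b \<bullet> i"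
    and lower: "\<And>x i. x \<in> cbox a b \<Longrightarrow> i \<in> Basis \<Longrightarrow> x \<bullet> i = a \<bullet> i \<Longrightarrow> F x \<bullet> i \<le> 0"
    and upper: "\<And>x i. x \<in> cbox a b \<Longrightarrow> i \<in> Basis \<Longrightarrow> x \<bullet> i = b \<bullet> i \<Longrightarrow> F x \<bullet> i \<ge> 0"
  obtains x where "x \<in> cbox a b" "F x = 0"
proof -
  have nonempty: "cbox a b \<noteq> {}"
    using box by (simp add: box_ne_empty)
  have "continuous_on UNIV (clamp a b)"
    using clamp_continuous_on[OF continuous_on_id] .
  then have "continuous_on (cbox a b) (\<lambda>x. clamp a b (x - F x))"
    by (rule continuous_on_compose2) (auto intro!: continuous_intros cont)
  moreover have "(\<lambda>x. clamp a b (x - F x)) \<in> cbox a b \<rightarrow> cbox a b"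
    using box by (auto intro!: clamp_in_interval)
  ultimately obtain x where x: "x \<in> cbox a b" and fx: "clamp a b (x - F x) = x"
    by (rule brouwer[OF compact_cbox convex_box(1) nonempty])
  have "F x \<bullet> i = 0" if i: "i \<in> Basis" for i
  proof -
    have "x \<bullet> i = clamp a b (x - F x) \<bullet> i"
      using fx by simp
    also have "\<dots> = (if (x - F x) \<bullet> i < a \<bullet> i then a \<bullet> i
        else if (x - F x) \<bullet> i \<le> b \<bullet> i then (x - F x) \<bullet> i else b \<bullet> i)"
      unfolding clamp_def using box i by simp
    finally have "x \<bullet> i = (if x \<bullet> i - F x \<bullet> i < a \<bullet> i then a \<bullet> i
        else if x \<bullet> i - F x \<bullet> i \<le> b \<bullet> i then x \<bullet> i - F x \<bullet> i else b \<bullet> i)"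
      by (simp only: inner_diff_left)
    with lower[OF x i] upper[OF x i] show ?thesis
      by argo
  qed
  then have "F x = 0"
    by (auto intro: euclidean_eqI)
  with x that show ?thesis by blast
qed

text \<open>The square of parameters \<open>(s, t)\<close> of a pair of paths, seen from its corner \<open>(0, 0)\<close> towards
  \<open>(1, 1)\<close>: a map of the unit square onto it that collapses the left side to the first corner and the
  right side to the second one, and folds the bottom side onto the two edges on one side of the
  diagonal and the top side onto the other two. It is \<open>(diamond a b, diamond a (1 - b))\<close>.\<close>

definition diamond :: "real \<Rightarrow> real \<Rightarrow> real" where
  "diamond a b = a + (2 * b - 1) * min a (1 - a)"

lemma diamond_sides:
  "diamond 0 b = 0" "diamond 1 b = 1"
  "diamond a 0 = 0 \<or> diamond a 1 = 1"
  by (auto simp: diamond_def min_def)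

lemma diamond_in_unit_interval:
  assumes "a \<in> {0..1}" "b \<in> {0..1}"
  shows "diamond a b \<in> {0..1}"
proof -
  have "\<bar>(2 * b - 1) * min a (1 - a)\<bar> \<le> 1 * min a (1 - a)"
    unfolding abs_mult using assms by (intro mult_mono) auto
  then show ?thesis
    using assms unfolding diamond_def by (auto simp: abs_le_iff)
qed

text \<open>Of the four unknowns, the difference of the two parameters on \<open>A\<close>, \<open>B\<close> serves to make the chord
  vertical and their sum moves it from left to right; those on \<open>C\<close>, \<open>E\<close> play the same part with the
  coordinates exchanged. With parameters in the shape of \<open>diamond\<close> this gives the sign
  conditions of \<open>poincare_miranda\<close>.\<close>

lemma crossing_chords:
  fixes A B C E :: "real \<Rightarrow> real \<times> real"
  assumes cont: "continuous_on {0..1} A" "continuous_on {0..1} B"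
      "continuous_on {0..1} C" "continuous_on {0..1} E"
    and ends: "fst (A 0) = l" "fst (B 0) = l" "fst (A 1) = r" "fst (B 1) = r"
      "snd (C 0) = d" "snd (E 0) = d" "snd (C 1) = u" "snd (E 1) = u"
    and rect: "\<And>s. s \<in> {0..1} \<Longrightarrow> A s \<in> {l..r} \<times> {d..u}" "\<And>s. s \<in> {0..1} \<Longrightarrow> B s \<in> {l..r} \<times> {d..u}"
      "\<And>s. s \<in> {0..1} \<Longrightarrow> C s \<in> {l..r} \<times> {d..u}" "\<And>s. s \<in> {0..1} \<Longrightarrow> E s \<in> {l..r} \<times> {d..u}"
  obtains s t s' t' where "s \<in> {0..1}" "t \<in> {0..1}" "s' \<in> {0..1}" "t' \<in> {0..1}"
    "fst (A s) = fst (B t)" "snd (C s') = snd (E t')" "A s + B t = C s' + E t'"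
proof -
  define \<sigma> \<tau> \<sigma>' \<tau>' :: "(real \<times> real) \<times> real \<times> real \<Rightarrow> real" where
    "\<sigma> z = diamond (fst (fst z)) (snd (fst z))" and
    "\<tau> z = diamond (fst (fst z)) (1 - snd (fst z))" and
    "\<sigma>' z = diamond (fst (snd z)) (snd (snd z))" and
    "\<tau>' z = diamond (fst (snd z)) (1 - snd (snd z))" for z
  note defs = \<sigma>_def \<tau>_def \<sigma>'_def \<tau>'_def
  \<comment> \<open>The first pair of coordinates of \<open>z\<close> belongs to the chord from \<open>A\<close> to \<open>B\<close>, the second one to the
    chord from \<open>C\<close> to \<open>E\<close>; in each, the first coordinate moves the chord and the second one tilts it.\<close>
  define F where "F z =
    ((fst (A (\<sigma> z)) + fst (B (\<tau> z)) - fst (C (\<sigma>' z)) - fst (E (\<tau>' z)), fst (A (\<sigma> z)) - fst (B (\<tau> z))),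
     (snd (C (\<sigma>' z)) + snd (E (\<tau>' z)) - snd (A (\<sigma> z)) - snd (B (\<tau> z)), snd (C (\<sigma>' z)) - snd (E (\<tau>' z))))"
    for z
  define Q :: "((real \<times> real) \<times> real \<times> real) set" where "Q = cbox ((0, 0), (0, 0)) ((1, 1), (1, 1))"
  have Q: "z \<in> Q \<longleftrightarrow> fst (fst z) \<in> {0..1} \<and> snd (fst z) \<in> {0..1} \<and> fst (snd z) \<in> {0..1} \<and> snd (snd z) \<in> {0..1}"
    for z
    unfolding Q_def by (cases z) (auto simp: cbox_Pair_eq)
  have cube: "\<sigma> z \<in> {0..1}" "\<tau> z \<in> {0..1}" "\<sigma>' z \<in> {0..1}" "\<tau>' z \<in> {0..1}" if "z \<in> Q" for z
    using that unfolding Q defs by (auto intro!: diamond_in_unit_interval simp del: atLeastAtMost_iff) auto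
  have range: "l \<le> fst (A (\<sigma> z))" "fst (A (\<sigma> z)) \<le> r" "l \<le> fst (B (\<tau> z))" "fst (B (\<tau> z)) \<le> r"
      "l \<le> fst (C (\<sigma>' z))" "fst (C (\<sigma>' z)) \<le> r" "l \<le> fst (E (\<tau>' z))" "fst (E (\<tau>' z)) \<le> r"
      "d \<le> snd (A (\<sigma> z))" "snd (A (\<sigma> z)) \<le> u" "d \<le> snd (B (\<tau> z))" "snd (B (\<tau> z)) \<le> u"
      "d \<le> snd (C (\<sigma>' z))" "snd (C (\<sigma>' z)) \<le> u" "d \<le> snd (E (\<tau>' z))" "snd (E (\<tau>' z)) \<le> u"
    if "z \<in> Q" for z
    using rect(1)[OF cube(1)[OF that]] rect(2)[OF cube(2)[OF that]]
      rect(3)[OF cube(3)[OF that]] rect(4)[OF cube(4)[OF that]]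
    by (simp_all add: mem_Times_iff)
  have cont_param: "continuous_on Q \<sigma>" "continuous_on Q \<tau>" "continuous_on Q \<sigma>'" "continuous_on Q \<tau>'"
    unfolding defs diamond_def by (intro continuous_intros)+
  have cont_paths: "continuous_on Q (\<lambda>z. A (\<sigma> z))" "continuous_on Q (\<lambda>z. B (\<tau> z))"
      "continuous_on Q (\<lambda>z. C (\<sigma>' z))" "continuous_on Q (\<lambda>z. E (\<tau>' z))"
    using cont cont_param cube by (auto intro!: continuous_on_compose2[of "{0..1}"] simp del: atLeastAtMost_iff)
  have "\<exists>z\<in>Q. F z = 0"
  proof (rule poincare_miranda[of "((0, 0), (0, 0))" "((1, 1), (1, 1))" F, folded Q_def])
    show "continuous_on Q F"
      unfolding F_def by (intro continuous_intros cont_paths)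
  next
    fix i :: "(real \<times> real) \<times> real \<times> real"
    assume "i \<in> Basis"
    then show "((0, 0), (0, 0)) \<bullet> i \<le> ((1, 1), (1, 1)) \<bullet> i"
      by (auto simp: Basis_prod_def)
  next
    fix z i :: "(real \<times> real) \<times> real \<times> real"
    assume z: "z \<in> Q" and i: "i \<in> Basis" and face: "z \<bullet> i = ((0, 0), (0, 0)) \<bullet> i"
    consider "i = ((1, 0), 0)" | "i = ((0, 1), 0)" | "i = (0, (1, 0))" | "i = (0, (0, 1))"
      using i by (auto simp: Basis_prod_def)
    then show "F z \<bullet> i \<le> 0"
    proof cases
      case 1
      then have "\<sigma> z = 0" "\<tau> z = 0"
        using face by (auto simp: defs inner_prod_def diamond_sides)
      then show ?thesis
        using 1 range[OF z] ends by (simp add: F_def)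
    next
      case 2
      then have "\<sigma> z = 0 \<or> \<tau> z = 1"
        using face diamond_sides(3) by (auto simp: defs inner_prod_def)
      then show ?thesis
        using 2 range[OF z] ends by (auto simp: F_def)
    next
      case 3
      then have "\<sigma>' z = 0" "\<tau>' z = 0"
        using face by (auto simp: defs inner_prod_def diamond_sides)
      then show ?thesis
        using 3 range[OF z] ends by (simp add: F_def)
    next
      case 4
      then have "\<sigma>' z = 0 \<or> \<tau>' z = 1"
        using face diamond_sides(3) by (auto simp: defs inner_prod_def)
      then show ?thesis
        using 4 range[OF z] ends by (auto simp: F_def)
    qed
  next
    fix z i :: "(real \<times> real) \<times> real \<times> real"
    assume z: "z \<in> Q" and i: "i \<in> Basis" and face: "z \<bullet> i = ((1, 1), (1, 1)) \<bullet> i"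
    consider "i = ((1, 0), 0)" | "i = ((0, 1), 0)" | "i = (0, (1, 0))" | "i = (0, (0, 1))"
      using i by (auto simp: Basis_prod_def)
    then show "F z \<bullet> i \<ge> 0"
    proof cases
      case 1
      then have "\<sigma> z = 1" "\<tau> z = 1"
        using face by (auto simp: defs inner_prod_def diamond_sides)
      then show ?thesis
        using 1 range[OF z] ends by (simp add: F_def)
    next
      case 2
      then have "\<tau> z = 0 \<or> \<sigma> z = 1"
        using face diamond_sides(3) by (auto simp: defs inner_prod_def)
      then show ?thesis
        using 2 range[OF z] ends by (auto simp: F_def)
    next
      case 3
      then have "\<sigma>' z = 1" "\<tau>' z = 1"
        using face by (auto simp: defs inner_prod_def diamond_sides)
      then show ?thesis
        using 3 range[OF z] ends by (simp add: F_def)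
    next
      case 4
      then have "\<tau>' z = 0 \<or> \<sigma>' z = 1"
        using face diamond_sides(3) by (auto simp: defs inner_prod_def)
      then show ?thesis
        using 4 range[OF z] ends by (auto simp: F_def)
    qed
  qed blast
  then obtain z where z: "z \<in> Q" "F z = 0" by blast
  then have "fst (A (\<sigma> z)) = fst (B (\<tau> z))" "snd (C (\<sigma>' z)) = snd (E (\<tau>' z))"
      "A (\<sigma> z) + B (\<tau> z) = C (\<sigma>' z) + E (\<tau>' z)"
    by (auto simp: F_def zero_prod_def prod_eq_iff)
  with cube[OF z(1)] that show ?thesis by blast
qed

section \<open>Degenerate crossings do not occur near the critical angle\<close>

text \<open>At the angle \<open>\<theta>\<^sub>0\<close> the paths \<open>C\<close>, \<open>E\<close> run from the minimal to the maximal height of \<open>G\<close>.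
  For other angles they are prolonged vertically to the common levels \<open>- H\<close> and \<open>H\<close>, so that
  \<open>crossing_chords\<close> applies at every angle at which \<open>p\<close> and \<open>q\<close> are extreme. It remains to see that
  near \<open>\<theta>\<^sub>0\<close> the crossing found consists of two proper chords of \<open>G\<close>.\<close>

lemma crossing_chords_stable:
  fixes A B C E :: "real \<Rightarrow> real^2"
  assumes paths: "path A" "path B" "path C" "path E"
    and G: "bounded G" "path_image A \<subseteq> G" "path_image B \<subseteq> G" "path_image C \<subseteq> G" "path_image E \<subseteq> G"
    and ends: "pathstart A = p" "pathstart B = p" "pathfinish A = q" "pathfinish B = q"
    and meet_AB: "path_image A \<inter> path_image B \<subseteq> {p, q}"
    and left: "\<forall>\<^sub>F \<theta> in nhds \<theta>\<^sub>0. \<forall>v\<in>G - {p}. along \<theta> p < along \<theta> v"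
    and right: "\<forall>\<^sub>F \<theta> in nhds \<theta>\<^sub>0. \<forall>v\<in>G - {q}. along \<theta> v < along \<theta> q"
    and heights: "\<And>v. v \<in> G \<Longrightarrow> across \<theta>\<^sub>0 v \<in> {lo..hi}"
      "across \<theta>\<^sub>0 (pathstart C) = lo" "across \<theta>\<^sub>0 (pathstart E) = lo"
      "across \<theta>\<^sub>0 (pathfinish C) = hi" "across \<theta>\<^sub>0 (pathfinish E) = hi"
    and meet_CE: "\<And>v. v \<in> path_image C \<Longrightarrow> v \<in> path_image E \<Longrightarrow> v \<notin> {p, q} \<and> across \<theta>\<^sub>0 v \<in> {lo, hi}"
  shows "\<forall>\<^sub>F \<theta> in nhds \<theta>\<^sub>0. \<exists>a\<in>G. \<exists>b\<in>G. \<exists>c\<in>G. \<exists>d\<in>G. rhombus_of_angle \<theta> a b c d"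
proof -
  \<comment> \<open>Paths are made constant outside the unit interval, which makes them continuous everywhere.\<close>
  define clip :: "real \<Rightarrow> real" where "clip u = max 0 (min 1 u)" for u
  have clip01: "clip u \<in> {0..1}" for u
    by (auto simp: clip_def)
  have clip_id: "clip u = u" if "u \<in> {0..1}" for u
    using that by (auto simp: clip_def)
  have clip_le: "clip u = 0" if "u \<le> 0" for u
    using that by (auto simp: clip_def)
  have clip_ge: "clip u = 1" if "u \<ge> 1" for u
    using that by (auto simp: clip_def)
  have cont_clip: "continuous_on S (\<lambda>x. K (clip (f x)))" if "path K" "continuous_on S f"
    for S :: "'x::t2_space set" and K :: "real \<Rightarrow> real^2" and f
  proof (rule continuous_on_compose2[of "{0..1}" K])
    show "continuous_on {0..1} K"
      using that(1) by (simp add: path_def)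
    show "continuous_on S (\<lambda>x. clip (f x))"
      unfolding clip_def by (intro continuous_intros that(2))
  qed (use clip01 in blast)
  have in_path: "K (clip u) \<in> path_image K" for K :: "real \<Rightarrow> real^2" and u
    using clip01 by (auto simp: path_image_def)
  have in_G: "A (clip u) \<in> G" "B (clip u) \<in> G" "C (clip u) \<in> G" "E (clip u) \<in> G" for u
    using in_path G by blast+
  obtain H where H: "norm v < H" if "v \<in> G" for v
  proof -
    obtain b where "\<And>v. v \<in> G \<Longrightarrow> norm v \<le> b"
      using G(1) unfolding bounded_iff by blast
    then show thesis
      by (intro that[of "b + 1"]) (meson le_less_trans less_add_one)
  qed
  have H': "\<bar>across \<theta> v\<bar> < H" if "v \<in> G" for \<theta> v
    using H[OF that] abs_across_le_norm[of \<theta> v] by linarith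

  \<comment> \<open>The prolongation of \<open>K\<close>: for parameters in \<open>{1..2}\<close> the point \<open>K 1\<close> is raised to \<open>H\<close>, and for those
    in \<open>{-1..0}\<close> the point \<open>K 0\<close> is lowered to \<open>- H\<close>; the coordinate \<open>along\<close> remains that of \<open>K (clip u)\<close>.\<close>
  define height where "height \<theta> K u = across \<theta> (K (clip u))
      + max 0 (u - 1) * (H - across \<theta> (K (clip 1))) - max 0 (- u) * (H + across \<theta> (K (clip 0)))"
    for \<theta> u and K :: "real \<Rightarrow> real^2"
  have height_inner: "height \<theta> K u = across \<theta> (K (clip u))" if "0 \<le> u" "u \<le> 1" for \<theta> K u
    using that by (simp add: height_def)
  have height_upper: "height \<theta> K u = across \<theta> (K (clip 1)) + (u - 1) * (H - across \<theta> (K (clip 1)))"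
    if "u \<ge> 1" for \<theta> K u
    using that by (simp add: height_def clip_ge)
  have height_lower: "height \<theta> K u = across \<theta> (K (clip 0)) + u * (H + across \<theta> (K (clip 0)))"
    if "u \<le> 0" for \<theta> K u
    using that by (simp add: height_def clip_le)
  have height_bound: "height \<theta> K u \<in> {- H..H}" if K: "\<And>u. K (clip u) \<in> G" and u: "u \<in> {-1..2}" for \<theta> K u
  proof -
    consider "u \<le> 0" | "0 \<le> u" "u \<le> 1" | "u \<ge> 1" by linarith
    then show ?thesis
    proof cases
      case 1
      let ?a = "across \<theta> (K (clip 0))"
      have a: "\<bar>?a\<bar> < H" by (rule H'[OF K])
      have "u * (H + ?a) \<le> 0" "(1 + u) * (H + ?a) \<ge> 0"
        using a 1 u by (auto intro!: mult_nonpos_nonneg)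
      then show ?thesis
        using a unfolding height_lower[OF 1] by (simp add: algebra_simps)
    next
      case 2
      then show ?thesis
        using H'[OF K, of \<theta> u] by (simp add: height_inner abs_less_iff)
    next
      case 3
      let ?a = "across \<theta> (K (clip 1))"
      have a: "\<bar>?a\<bar> < H" by (rule H'[OF K])
      have "(u - 1) * (H - ?a) \<ge> 0" "(2 - u) * (H - ?a) \<ge> 0"
        using a 3 u by auto
      then show ?thesis
        using a unfolding height_upper[OF 3] by (simp add: algebra_simps)
    qed
  qed
  have cont_height: "continuous_on S (\<lambda>x. height (f x) K (k x))"
    if "path K" "continuous_on S f" "continuous_on S k"
    for S :: "'x::t2_space set" and K :: "real \<Rightarrow> real^2" and f k
    unfolding height_def by (intro continuous_intros cont_clip that)

  define crossing where "crossing \<theta> s t u v \<longleftrightarrow>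
      along \<theta> (A (clip s)) = along \<theta> (B (clip t)) \<and> height \<theta> C u = height \<theta> E v \<and>
      along \<theta> (A (clip s)) + along \<theta> (B (clip t)) = along \<theta> (C (clip u)) + along \<theta> (E (clip v)) \<and>
      across \<theta> (A (clip s)) + across \<theta> (B (clip t)) = height \<theta> C u + height \<theta> E v" for \<theta> s t u v
  \<comment> \<open>The ends \<open>0\<close> and \<open>1\<close> of \<open>C\<close>, \<open>E\<close> count as degenerate in order that the condition is closed; they are
    as harmless as the vertical segments, since at \<open>\<theta>\<^sub>0\<close> they have extreme height.\<close>
  define degenerate where "degenerate s t u v \<longleftrightarrow>
      u \<le> 0 \<or> u \<ge> 1 \<or> v \<le> 0 \<or> v \<ge> 1 \<or> C (clip u) = E (clip v) \<or> A (clip s) = B (clip t)" for s t u v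

  have crossing_ex: "\<exists>s t u v. s \<in> {0..1} \<and> t \<in> {0..1} \<and> u \<in> {-1..2} \<and> v \<in> {-1..2} \<and> crossing \<theta> s t u v"
    if l: "\<forall>v\<in>G - {p}. along \<theta> p < along \<theta> v" and r: "\<forall>v\<in>G - {q}. along \<theta> v < along \<theta> q" for \<theta>
  proof -
    have lr: "along \<theta> v \<in> {along \<theta> p..along \<theta> q}" if "v \<in> G" for v
      using l r that by (metis Diff_iff atLeastAtMost_iff empty_iff insert_iff less_eq_real_def)
    let ?arc = "\<lambda>K s. (along \<theta> (K (clip s)), across \<theta> (K (clip s)))"
    let ?ext = "\<lambda>K s. (along \<theta> (K (clip (3 * s - 1))), height \<theta> K (3 * s - 1))"
    have "\<exists>s t s' t'. s \<in> {0..1} \<and> t \<in> {0..1} \<and> s' \<in> {0..1} \<and> t' \<in> {0..1} \<and>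
        fst (?arc A s) = fst (?arc B t) \<and> snd (?ext C s') = snd (?ext E t') \<and>
        ?arc A s + ?arc B t = ?ext C s' + ?ext E t'"
    proof (rule crossing_chords[of "?arc A" "?arc B" "?ext C" "?ext E"
          "along \<theta> p" "along \<theta> q" "- H" H])
      show "continuous_on {0..1} (?arc A)" "continuous_on {0..1} (?arc B)"
          "continuous_on {0..1} (?ext C)" "continuous_on {0..1} (?ext E)"
        by (intro continuous_intros cont_clip cont_height paths)+
      show "fst (?arc A 0) = along \<theta> p" "fst (?arc B 0) = along \<theta> p"
          "fst (?arc A 1) = along \<theta> q" "fst (?arc B 1) = along \<theta> q"
        using ends by (auto simp: clip_def pathstart_def pathfinish_def)
      show "snd (?ext C 0) = - H" "snd (?ext E 0) = - H" "snd (?ext C 1) = H" "snd (?ext E 1) = H"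
        by (simp_all add: height_lower height_upper)
      have "across \<theta> v \<in> {- H..H}" if "v \<in> G" for v
        using H'[OF that, of \<theta>] by (simp add: abs_less_iff)
      then show "?arc A s \<in> {along \<theta> p..along \<theta> q} \<times> {- H..H}"
          "?arc B s \<in> {along \<theta> p..along \<theta> q} \<times> {- H..H}" for s
        using lr in_G by blast+
      show "?ext C s \<in> {along \<theta> p..along \<theta> q} \<times> {- H..H}"
          "?ext E s \<in> {along \<theta> p..along \<theta> q} \<times> {- H..H}" if "s \<in> {0..1}" for s
        using that lr in_G height_bound[of C "3 * s - 1"] height_bound[of E "3 * s - 1"] by auto
    qed blast
    then obtain s t s' t' where "s \<in> {0..1}" "t \<in> {0..1}" "s' \<in> {0..1}" "t' \<in> {0..1}"
      "crossing \<theta> s t (3 * s' - 1) (3 * t' - 1)"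
      unfolding crossing_def by auto
    moreover from this have "3 * s' - 1 \<in> {-1..2}" "3 * t' - 1 \<in> {-1..2}"
      by auto
    ultimately show ?thesis by blast
  qed

  have l0: "\<forall>v\<in>G - {p}. along \<theta>\<^sub>0 p < along \<theta>\<^sub>0 v" and r0: "\<forall>v\<in>G - {q}. along \<theta>\<^sub>0 v < along \<theta>\<^sub>0 q"
    using left right by (auto dest: eventually_nhds_x_imp_x)
  have nondegenerate: False if cr: "crossing \<theta>\<^sub>0 s t u v" and deg: "degenerate s t u v" for s t u v
  proof -
    have CE01: "across \<theta>\<^sub>0 (C (clip 0)) = lo" "across \<theta>\<^sub>0 (E (clip 0)) = lo"
        "across \<theta>\<^sub>0 (C (clip 1)) = hi" "across \<theta>\<^sub>0 (E (clip 1)) = hi"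
      using heights by (simp_all add: clip_def pathstart_def pathfinish_def)
    have hiH: "hi < H" "- H < lo"
      using H'[OF in_G(3), of \<theta>\<^sub>0 1] H'[OF in_G(3), of \<theta>\<^sub>0 0] CE01 by auto
    have low: "height \<theta>\<^sub>0 K w \<le> lo" if "w \<le> 0" "across \<theta>\<^sub>0 (K (clip 0)) = lo" for K w
      using that hiH by (simp add: height_lower mult_nonpos_nonneg)
    have high: "height \<theta>\<^sub>0 K w \<ge> hi" if "w \<ge> 1" "across \<theta>\<^sub>0 (K (clip 1)) = hi" for K w
      using that hiH by (simp add: height_upper)
    let ?k = "height \<theta>\<^sub>0 C u"
    have k: "height \<theta>\<^sub>0 E v = ?k"
      and x_AB: "along \<theta>\<^sub>0 (A (clip s)) = along \<theta>\<^sub>0 (B (clip t))"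
      and x_mid: "along \<theta>\<^sub>0 (A (clip s)) + along \<theta>\<^sub>0 (B (clip t)) = along \<theta>\<^sub>0 (C (clip u)) + along \<theta>\<^sub>0 (E (clip v))"
      and y_mid: "across \<theta>\<^sub>0 (A (clip s)) + across \<theta>\<^sub>0 (B (clip t)) = 2 * ?k"
      using cr by (auto simp: crossing_def)
    have yA: "across \<theta>\<^sub>0 (A (clip s)) \<in> {lo..hi}" and yB: "across \<theta>\<^sub>0 (B (clip t)) \<in> {lo..hi}"
      using heights(1) in_G by auto
    \<comment> \<open>An average of two heights of \<open>G\<close> is extreme only if both heights are.\<close>
    have AB: "A (clip s) = B (clip t)"
    proof (cases "?k \<le> lo \<or> hi \<le> ?k")
      case True
      then have "across \<theta>\<^sub>0 (A (clip s)) = across \<theta>\<^sub>0 (B (clip t))"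
        using yA yB y_mid by auto
      with x_AB show ?thesis by (rule frame_eqI)
    next
      case False
      then have inner: "0 < u" "u < 1" "0 < v" "v < 1"
        using low[of u C] low[of v E] high[of u C] high[of v E] CE01 k by force+
      have "C (clip u) \<noteq> E (clip v)"
      proof
        assume "C (clip u) = E (clip v)"
        then have "across \<theta>\<^sub>0 (C (clip u)) \<in> {lo, hi}"
          using meet_CE[of "C (clip u)"] in_path[of C u] in_path[of E v] by simp
        then show False
          using False inner by (auto simp: height_inner)
      qed
      then show ?thesis
        using deg inner by (auto simp: degenerate_def)
    qed
    then have corner: "A (clip s) \<in> {p, q}"
      using meet_AB in_path[of A s] in_path[of B t] by auto
    have x2: "along \<theta>\<^sub>0 (C (clip u)) + along \<theta>\<^sub>0 (E (clip v)) = 2 * along \<theta>\<^sub>0 (A (clip s))"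
      using x_mid x_AB by simp
    \<comment> \<open>The average of two values of \<open>along\<close> on \<open>G\<close> is extreme, and only one point of \<open>G\<close> attains the
      extreme.\<close>
    have "C (clip u) = A (clip s)" "E (clip v) = A (clip s)"
    proof -
      have *: "C (clip u) = w \<and> E (clip v) = w"
        if "w = A (clip s)" "w = p" for w
        using that x2 l0 in_G(3)[of u] in_G(4)[of v]
        by (smt (verit) DiffI singletonD)
      have **: "C (clip u) = w \<and> E (clip v) = w"
        if "w = A (clip s)" "w = q" for w
        using that x2 r0 in_G(3)[of u] in_G(4)[of v]
        by (smt (verit) DiffI singletonD)
      show "C (clip u) = A (clip s)" "E (clip v) = A (clip s)"
        using * ** corner by auto
    qed
    then show False
      using meet_CE[of "A (clip s)"] corner in_path[of C u] in_path[of E v] by auto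
  qed

  define K :: "(real \<times> real \<times> real \<times> real) set" where "K = {0..1} \<times> {0..1} \<times> {-1..2} \<times> {-1..2}"
  define Z where "Z = {((s, t, u, v), \<theta>). crossing \<theta> s t u v \<and> degenerate s t u v}"
  have "closed Z"
    unfolding Z_def crossing_def degenerate_def case_prod_unfold
    by (intro closed_Collect_conj closed_Collect_disj closed_Collect_eq closed_Collect_le
        continuous_intros cont_clip cont_height paths)
  moreover have "compact K"
    unfolding K_def by (intro compact_Times compact_Icc)
  ultimately have "closed {\<theta>. \<exists>x. x \<in> K \<and> (x, \<theta>) \<in> Z}"
    by (intro closed_compact_projection)
  moreover have "\<theta>\<^sub>0 \<notin> {\<theta>. \<exists>x. x \<in> K \<and> (x, \<theta>) \<in> Z}"
    using nondegenerate by (auto simp: Z_def)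
  ultimately have "\<forall>\<^sub>F \<theta> in nhds \<theta>\<^sub>0. \<theta> \<in> - {\<theta>. \<exists>x. x \<in> K \<and> (x, \<theta>) \<in> Z}"
    by (intro eventually_nhds_in_open) auto
  then show ?thesis
    using left right
  proof eventually_elim
    case (elim \<theta>)
    obtain s t u v where par: "s \<in> {0..1}" "t \<in> {0..1}" "u \<in> {-1..2}" "v \<in> {-1..2}"
      and cr: "crossing \<theta> s t u v"
      using crossing_ex[OF elim(2,3)] by blast
    then have nd: "\<not> degenerate s t u v"
      using elim(1) by (auto simp: K_def Z_def)
    have "height \<theta> C u = across \<theta> (C (clip u))" "height \<theta> E v = across \<theta> (E (clip v))"
      using nd by (auto simp: degenerate_def height_inner)
    with cr have eqs: "along \<theta> (A (clip s)) = along \<theta> (B (clip t))"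
        "across \<theta> (C (clip u)) = across \<theta> (E (clip v))"
        "C (clip u) + E (clip v) = A (clip s) + B (clip t)"
      by (auto simp: crossing_def along_add across_add intro!: frame_eqI[of \<theta>])
    have "C (clip u) \<noteq> E (clip v)" "A (clip s) \<noteq> B (clip t)"
      using nd by (auto simp: degenerate_def)
    from rhombus_of_angle_crossing_chords[OF this eqs(2,1,3)]
    show ?case
      using in_G by blast
  qed
qed

section \<open>Arcs of a closed curve between its extreme heights\<close>

lemma jordan_curve_loop:
  assumes "jordan_curve \<gamma>" "p \<in> curve_image \<gamma>"
  obtains g where "simple_path g" "path_image g = curve_image \<gamma>" "pathstart g = p" "pathfinish g = p"
proof -
  have cont: "continuous_on (sphere 0 1) \<gamma>" and inj: "inj_on \<gamma> (sphere 0 1)"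
    using assms(1) by (auto simp: jordan_curve_def)
  obtain z where z: "norm z = 1" "\<gamma> z = p"
    using assms(2) by (auto simp: curve_image_def)
  define w where "w t = z * cis (2 * pi * t)" for t
  have w: "w t \<in> sphere 0 1" for t
    using z by (simp add: w_def norm_mult)
  have "path (\<gamma> \<circ> w)"
    unfolding path_def comp_def
  proof (rule continuous_on_compose2[OF cont])
    show "continuous_on {0..1} w"
      unfolding w_def cis_conv_exp by (intro continuous_intros)
  qed (use w in blast)
  moreover have "loop_free (\<gamma> \<circ> w)"
    unfolding loop_free_def
  proof (intro ballI impI)
    fix x y :: real
    assume xy: "x \<in> {0..1}" "y \<in> {0..1}" and "(\<gamma> \<circ> w) x = (\<gamma> \<circ> w) y"
    then have "w x = w y"
      using inj w by (auto dest: inj_onD)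
    then have "cis (2 * pi * x) = cis (2 * pi * y)"
      using z by (auto simp: w_def)
    then have "sin (2 * pi * y) = sin (2 * pi * x) \<and> cos (2 * pi * y) = cos (2 * pi * x)"
      by (simp add: complex_eq_iff)
    then obtain n :: int where "2 * pi * y = 2 * pi * x + 2 * pi * of_int n"
      using sin_cos_eq_iff by blast
    then have "2 * pi * (y - x - of_int n) = 0"
      by (simp add: algebra_simps)
    then have n: "y = x + of_int n" by simp
    then have "real_of_int n \<le> 1" "- 1 \<le> real_of_int n"
      using xy by auto
    then have "n = 0 \<or> n = 1 \<or> n = - 1" by linarith
    then show "x = y \<or> x = 0 \<and> y = 1 \<or> x = 1 \<and> y = 0"
      using xy n by auto
  qed
  moreover have "path_image (\<gamma> \<circ> w) = curve_image \<gamma>"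
  proof -
    have "w ` {0..1} = sphere 0 1"
    proof
      show "w ` {0..1} \<subseteq> sphere 0 1"
        using w by blast
      show "sphere 0 1 \<subseteq> w ` {0..1}"
      proof
        fix v :: complex assume "v \<in> sphere 0 1"
        then have "norm (v / z) = 1"
          using z by (simp add: norm_divide)
        then have "(Re (v / z))\<^sup>2 + (Im (v / z))\<^sup>2 = 1"
          by (metis cmod_power2 one_power2)
        then obtain \<phi> where \<phi>: "0 \<le> \<phi>" "\<phi> < 2 * pi" "Re (v / z) = cos \<phi>" "Im (v / z) = sin \<phi>"
          by (rule sincos_total_2pi)
        then have "v / z = cis \<phi>"
          by (simp add: complex_eq_iff)
        moreover have "z \<noteq> 0"
          using z by auto
        ultimately have "v = w (\<phi> / (2 * pi))"
          by (simp add: w_def field_simps)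
        then show "v \<in> w ` {0..1}"
          using \<phi> by (auto simp: field_simps)
      qed
    qed
    then show ?thesis
      unfolding path_image_def curve_image_def image_comp[symmetric] by simp
  qed
  moreover have "pathstart (\<gamma> \<circ> w) = p" "pathfinish (\<gamma> \<circ> w) = p"
    using z by (simp_all add: pathstart_def pathfinish_def w_def)
  ultimately show thesis
    using that unfolding simple_path_def by blast
qed

text \<open>One path ends at \<open>p\<close>, the other one at \<open>q\<close>, and both start at a lowest point. If even the
  lowest points have the height of \<open>p\<close>, then \<open>h\<close> is constant on the curve and every point other than
  \<open>p\<close>, \<open>q\<close> can serve as the start.\<close>

lemma level_paths_from_top:
  fixes g :: "real \<Rightarrow> 'a::real_normed_vector" and h :: "'a \<Rightarrow> real"
  assumes g: "simple_path g" "pathfinish g = pathstart g"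
    and pq: "p \<in> path_image g" "q \<in> path_image g" "p \<noteq> q" "h p = h q"
    and cont: "continuous_on (path_image g) h"
    and top: "\<And>v. v \<in> path_image g \<Longrightarrow> h v \<le> h p"
  obtains C E lo hi where "path C" "path E" "path_image C \<subseteq> path_image g" "path_image E \<subseteq> path_image g"
    "h (pathstart C) = lo" "h (pathstart E) = lo" "h (pathfinish C) = hi" "h (pathfinish E) = hi"
    "\<And>v. v \<in> path_image g \<Longrightarrow> h v \<in> {lo..hi}"
    "\<And>v. v \<in> path_image C \<Longrightarrow> v \<in> path_image E \<Longrightarrow> v \<notin> {p, q} \<and> h v \<in> {lo, hi}"
proof -
  obtain u d where arcs: "arc u" "arc d" "pathstart u = p" "pathfinish u = q"
      "pathstart d = q" "pathfinish d = p" "path_image u \<union> path_image d = path_image g"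
    using exists_double_arc[OF g pq(1,2,3)] by metis
  obtain D where D: "D \<in> path_image g" "D \<notin> {p, q}" "\<And>v. v \<in> path_image g \<Longrightarrow> h D \<le> h v"
  proof -
    have "compact (path_image g)" "path_image g \<noteq> {}"
      using g(1) compact_simple_path_image pq(1) by auto
    then obtain D where D: "D \<in> path_image g" "\<And>v. v \<in> path_image g \<Longrightarrow> h D \<le> h v"
      using continuous_attains_inf[OF _ _ cont] by blast
    show thesis
    proof (cases "D \<in> {p, q}")
      case False
      with D that show thesis by blast
    next
      case True
      have half: "u (1/2) \<in> path_image u"
        by (auto simp: path_image_def)
      then have mem: "u (1/2) \<in> path_image g"
        using arcs by blast
      have "u (1/2) \<notin> {p, q}"
        using arcs(1,3,4) by (auto simp: arc_def pathstart_def pathfinish_def dest: inj_onD)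
      moreover have "h (u (1/2)) \<le> h v" if "v \<in> path_image g" for v
        using True D(2)[OF that] top[OF mem] pq(4) by auto
      ultimately show thesis
        using mem that by blast
    qed
  qed
  obtain R where R: "arc R" "{pathstart R, pathfinish R} = {p, q}" "D \<in> path_image R"
      "path_image R \<subseteq> path_image g"
    using arcs D(1) by (metis UnE Un_upper1 Un_upper2 insert_commute)
  obtain s where s: "s \<in> {0..1}" "R s = D"
    using R(3) by (auto simp: path_image_def)
  have inj: "inj_on R {0..1}" and path: "path R"
    using R(1) by (auto simp: arc_def)
  have sub: "path_image (subpath s 0 R) = R ` {0..s}" "path_image (subpath s 1 R) = R ` {s..1}"
    using s(1) by (auto simp: path_image_subpath)
  show thesis
  proof (rule that[of "subpath s 0 R" "subpath s 1 R" "h D" "h p"])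
    show "path (subpath s 0 R)" "path (subpath s 1 R)"
      using s(1) path by (auto intro: path_subpath)
    show "path_image (subpath s 0 R) \<subseteq> path_image g" "path_image (subpath s 1 R) \<subseteq> path_image g"
      using R(4) s(1) unfolding sub by (auto simp: path_image_def)
    show "h (pathstart (subpath s 0 R)) = h D" "h (pathstart (subpath s 1 R)) = h D"
      using s(2) by simp_all
    show "h (pathfinish (subpath s 0 R)) = h p" "h (pathfinish (subpath s 1 R)) = h p"
      using R(2) pq(4) unfolding pathfinish_subpath by (auto simp: pathstart_def pathfinish_def doubleton_eq_iff)
    show "h v \<in> {h D..h p}" if "v \<in> path_image g" for v
      using that top D(3) by simp
    show "v \<notin> {p, q} \<and> h v \<in> {h D, h p}"
      if v: "v \<in> path_image (subpath s 0 R)" "v \<in> path_image (subpath s 1 R)" for v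
    proof -
      obtain a b where "a \<in> {0..s}" "b \<in> {s..1}" "v = R a" "v = R b"
        using v unfolding sub by blast
      moreover from this have "a = b"
        using inj s(1) by (auto dest: inj_onD)
      ultimately have "v = D"
        using s(2) by auto
      then show ?thesis
        using D(2) by simp
    qed
  qed
qed

text \<open>If the height of \<open>p\<close> and \<open>q\<close> is not extreme, then a lowest and a highest point divide the curve
  into two suitable arcs. Otherwise \<open>level_paths_from_top\<close> applies, to \<open>h\<close> or, with reversed paths, to
  \<open>- h\<close>.\<close>

lemma level_paths:
  fixes g :: "real \<Rightarrow> 'a::real_normed_vector" and h :: "'a \<Rightarrow> real"
  assumes g: "simple_path g" "pathfinish g = pathstart g"
    and pq: "p \<in> path_image g" "q \<in> path_image g" "p \<noteq> q" "h p = h q"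
    and cont: "continuous_on (path_image g) h"
  obtains C E lo hi where "path C" "path E" "path_image C \<subseteq> path_image g" "path_image E \<subseteq> path_image g"
    "h (pathstart C) = lo" "h (pathstart E) = lo" "h (pathfinish C) = hi" "h (pathfinish E) = hi"
    "\<And>v. v \<in> path_image g \<Longrightarrow> h v \<in> {lo..hi}"
    "\<And>v. v \<in> path_image C \<Longrightarrow> v \<in> path_image E \<Longrightarrow> v \<notin> {p, q} \<and> h v \<in> {lo, hi}"
proof -
  have compact: "compact (path_image g)" and nonempty: "path_image g \<noteq> {}"
    using g(1) compact_simple_path_image pq(1) by auto
  obtain D where D: "D \<in> path_image g" "\<And>v. v \<in> path_image g \<Longrightarrow> h D \<le> h v"
    using continuous_attains_inf[OF compact nonempty cont] by blast
  obtain T where T: "T \<in> path_image g" "\<And>v. v \<in> path_image g \<Longrightarrow> h v \<le> h T"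
    using continuous_attains_sup[OF compact nonempty cont] by blast
  consider "h T = h p" | "h D = h p" | "h D < h p" "h p < h T"
    using D(2)[OF pq(1)] T(2)[OF pq(1)] by linarith
  then show thesis
  proof cases
    case 1
    then have "\<And>v. v \<in> path_image g \<Longrightarrow> h v \<le> h p"
      using T(2) by simp
    from level_paths_from_top[OF g pq cont this] that show thesis by metis
  next
    case 2
    have "\<And>v. v \<in> path_image g \<Longrightarrow> - h v \<le> - h p" "- h p = - h q"
      "continuous_on (path_image g) (\<lambda>v. - h v)"
      using D(2) 2 pq(4) by (auto intro: continuous_intros cont)
    from level_paths_from_top[of g p q "\<lambda>v. - h v", OF g pq(1,2,3) this(2,3,1)]
    obtain C E lo hi where CE: "path C" "path E" "path_image C \<subseteq> path_image g" "path_image E \<subseteq> path_image g"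
      "- h (pathstart C) = lo" "- h (pathstart E) = lo" "- h (pathfinish C) = hi" "- h (pathfinish E) = hi"
      "\<And>v. v \<in> path_image g \<Longrightarrow> - h v \<in> {lo..hi}"
      "\<And>v. v \<in> path_image C \<Longrightarrow> v \<in> path_image E \<Longrightarrow> v \<notin> {p, q} \<and> - h v \<in> {lo, hi}"
      by metis
    show thesis
    proof (rule that[of "reversepath C" "reversepath E" "- hi" "- lo"])
      show "h v \<in> {- hi..- lo}" if "v \<in> path_image g" for v
        using CE(9)[OF that] by auto
      show "v \<notin> {p, q} \<and> h v \<in> {- hi, - lo}"
        if "v \<in> path_image (reversepath C)" "v \<in> path_image (reversepath E)" for v
        using that CE(10)[of v] by auto
    qed (use CE(1-8) in auto)
  next
    case 3
    then have "D \<noteq> T" by auto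
    then obtain u d where arcs: "arc u" "arc d" "pathstart u = D" "pathfinish u = T"
        "pathstart d = T" "pathfinish d = D" "path_image u \<inter> path_image d = {D, T}"
        "path_image u \<union> path_image d = path_image g"
      using exists_double_arc[OF g D(1) T(1)] by metis
    show thesis
    proof (rule that[of u "reversepath d" "h D" "h T"])
      show "v \<notin> {p, q} \<and> h v \<in> {h D, h T}"
        if "v \<in> path_image u" "v \<in> path_image (reversepath d)" for v
        using that 3 pq(4) equalityD1[OF arcs(7)] by auto
      show "h v \<in> {h D..h T}" if "v \<in> path_image g" for v
        using D T that by simp
    qed (use arcs in \<open>auto simp: arc_imp_path\<close>)
  qed
qed

section \<open>Special corners\<close>

text \<open>The curve without \<open>p\<close> lies in one open quadrant bounded by the two lines of the corner, the one
  of \<open>q\<close>. The direction from \<open>p\<close> to \<open>q\<close> therefore has positive components along both sides of the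
  quadrant, as have the directions close to it, and two vectors with positive components have a
  positive inner product. The factor \<open>along \<theta>\<^sub>0 q - along \<theta>\<^sub>0 p\<close> tells whether \<open>p\<close> is the left or the
  right one of the two points.\<close>

lemma special_corner_strict_extreme:
  assumes \<gamma>: "jordan_curve \<gamma>" and p: "special_corner \<gamma> p"
    and q: "q \<in> curve_image \<gamma>" "q \<noteq> p" "across \<theta>\<^sub>0 q = across \<theta>\<^sub>0 p"
  shows "\<forall>\<^sub>F \<theta> in nhds \<theta>\<^sub>0. \<forall>v\<in>curve_image \<gamma> - {p}.
    0 < (along \<theta>\<^sub>0 q - along \<theta>\<^sub>0 p) * (along \<theta> v - along \<theta> p)"
proof -
  obtain \<alpha> where \<alpha>: "special_corner_of_angle \<gamma> \<alpha> p"
    using p by (auto simp: special_corner_def)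
  then have pG: "p \<in> curve_image \<gamma>"
    by (simp add: special_corner_of_angle_def)
  have "line_of_angle \<alpha> {v. across \<alpha> v = across \<alpha> p}"
    unfolding line_of_angle_across by (rule exI, rule refl)
  then have across_line: "{v. across \<alpha> v = across \<alpha> p} \<inter> curve_image \<gamma> = {p}"
    using \<alpha> unfolding special_corner_of_angle_def by simp
  have "line_of_angle (\<alpha> + pi / 2) {v. along \<alpha> v = along \<alpha> p}"
    unfolding line_of_angle_along by (rule exI, rule refl)
  then have along_line: "{v. along \<alpha> v = along \<alpha> p} \<inter> curve_image \<gamma> = {p}"
    using \<alpha> unfolding special_corner_of_angle_def by simp
  have off_lines: "across \<alpha> v \<noteq> across \<alpha> p" "along \<alpha> v \<noteq> along \<alpha> p"
    if "v \<in> curve_image \<gamma> - {p}" for v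
    using that across_line along_line by auto
  obtain g where g: "simple_path g" "path_image g = curve_image \<gamma>" "pathstart g = p" "pathfinish g = p"
    using jordan_curve_loop[OF \<gamma> pG] .
  have conn: "connected (curve_image \<gamma> - {p})"
    using connected_simple_path_endless[OF g(1)] g by simp
  \<comment> \<open>The curve without \<open>p\<close> cannot pass from one side of a line of the corner to the other.\<close>
  have same_sign: "0 < (f q - f p) * (f v - f p)"
    if f: "continuous_on UNIV f" "\<And>v. v \<in> curve_image \<gamma> - {p} \<Longrightarrow> f v \<noteq> f p"
      and v: "v \<in> curve_image \<gamma> - {p}" for f :: "real^2 \<Rightarrow> real" and v
  proof (rule ccontr)
    assume "\<not> 0 < (f q - f p) * (f v - f p)"
    then have "f q \<le> f p \<and> f p \<le> f v \<or> f v \<le> f p \<and> f p \<le> f q"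
      by (auto simp: not_less mult_le_0_iff)
    moreover have "connected (f ` (curve_image \<gamma> - {p}))"
      using f(1) conn by (intro connected_continuous_image) (auto intro: continuous_on_subset)
    ultimately have "f p \<in> f ` (curve_image \<gamma> - {p})"
      using q v unfolding connected_iff_interval by blast
    then show False
      using f(2) by force
  qed
  define r where "r = along \<theta>\<^sub>0 q - along \<theta>\<^sub>0 p"
  have q_frame: "along \<alpha> q - along \<alpha> p = cos (\<theta>\<^sub>0 - \<alpha>) * r" "across \<alpha> q - across \<alpha> p = sin (\<theta>\<^sub>0 - \<alpha>) * r"
  proof -
    have "cos (\<alpha> - \<theta>\<^sub>0) = cos (\<theta>\<^sub>0 - \<alpha>)" "sin (\<alpha> - \<theta>\<^sub>0) = - sin (\<theta>\<^sub>0 - \<alpha>)"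
      using cos_minus[of "\<theta>\<^sub>0 - \<alpha>"] sin_minus[of "\<theta>\<^sub>0 - \<alpha>"] by simp_all
    then show "along \<alpha> q - along \<alpha> p = cos (\<theta>\<^sub>0 - \<alpha>) * r" "across \<alpha> q - across \<alpha> p = sin (\<theta>\<^sub>0 - \<alpha>) * r"
      using frame_change[of \<alpha> q \<theta>\<^sub>0] frame_change[of \<alpha> p \<theta>\<^sub>0] q(3) by (simp_all add: r_def algebra_simps)
  qed
  have nz: "cos (\<theta>\<^sub>0 - \<alpha>) \<noteq> 0" "sin (\<theta>\<^sub>0 - \<alpha>) \<noteq> 0"
    using off_lines[of q] q q_frame by auto
  have "((\<lambda>\<theta>. cos (\<theta>\<^sub>0 - \<alpha>) * cos (\<theta> - \<alpha>)) \<longlongrightarrow> cos (\<theta>\<^sub>0 - \<alpha>) * cos (\<theta>\<^sub>0 - \<alpha>)) (nhds \<theta>\<^sub>0)"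
    by (intro tendsto_intros filterlim_ident)
  then have ev_cos: "\<forall>\<^sub>F \<theta> in nhds \<theta>\<^sub>0. 0 < cos (\<theta>\<^sub>0 - \<alpha>) * cos (\<theta> - \<alpha>)"
    by (rule order_tendstoD) (use nz in \<open>auto simp: zero_less_mult_iff linorder_neq_iff\<close>)
  have "((\<lambda>\<theta>. sin (\<theta>\<^sub>0 - \<alpha>) * sin (\<theta> - \<alpha>)) \<longlongrightarrow> sin (\<theta>\<^sub>0 - \<alpha>) * sin (\<theta>\<^sub>0 - \<alpha>)) (nhds \<theta>\<^sub>0)"
    by (intro tendsto_intros filterlim_ident)
  then have ev_sin: "\<forall>\<^sub>F \<theta> in nhds \<theta>\<^sub>0. 0 < sin (\<theta>\<^sub>0 - \<alpha>) * sin (\<theta> - \<alpha>)"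
    by (rule order_tendstoD) (use nz in \<open>auto simp: zero_less_mult_iff linorder_neq_iff\<close>)
  show ?thesis
    using ev_cos ev_sin
  proof eventually_elim
    case (elim \<theta>)
    show ?case
    proof
      fix v assume v: "v \<in> curve_image \<gamma> - {p}"
      have cont: "continuous_on UNIV (along \<alpha>)" "continuous_on UNIV (across \<alpha>)"
        by (intro continuous_on_frame continuous_on_const continuous_on_id)+
      have 1: "0 < cos (\<theta>\<^sub>0 - \<alpha>) * r * (along \<alpha> v - along \<alpha> p)"
        using same_sign[OF cont(1) off_lines(2) v] q_frame by simp
      have 2: "0 < sin (\<theta>\<^sub>0 - \<alpha>) * r * (across \<alpha> v - across \<alpha> p)"
        using same_sign[OF cont(2) off_lines(1) v] q_frame by simp
      have scale: "0 < b * c" if "0 < a * c" "0 < a * b" for a b c :: real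
        using that by (auto simp: zero_less_mult_iff)
      have "0 < cos (\<theta> - \<alpha>) * (r * (along \<alpha> v - along \<alpha> p))"
           "0 < sin (\<theta> - \<alpha>) * (r * (across \<alpha> v - across \<alpha> p))"
        using scale[OF 1[unfolded mult.assoc] elim(1)] scale[OF 2[unfolded mult.assoc] elim(2)] .
      moreover have eq: "along \<theta> v - along \<theta> p
          = cos (\<theta> - \<alpha>) * (along \<alpha> v - along \<alpha> p) + sin (\<theta> - \<alpha>) * (across \<alpha> v - across \<alpha> p)"
        by (simp add: frame_change[of \<theta> _ \<alpha>] algebra_simps)
      ultimately show "0 < (along \<theta>\<^sub>0 q - along \<theta>\<^sub>0 p) * (along \<theta> v - along \<theta> p)"
        unfolding r_def[symmetric] eq by (simp add: algebra_simps)
    qed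
  qed
qed

lemma eventually_inscribed_rhombus:
  assumes \<gamma>: "jordan_curve \<gamma>" and corners: "special_corner \<gamma> p" "special_corner \<gamma> q"
    and level: "across \<theta>\<^sub>0 p = across \<theta>\<^sub>0 q" and less: "along \<theta>\<^sub>0 p < along \<theta>\<^sub>0 q"
  shows "\<forall>\<^sub>F \<theta> in nhds \<theta>\<^sub>0. \<exists>S. inscribed_rhombus_of_angle \<gamma> \<theta> S"
proof -
  let ?G = "curve_image \<gamma>"
  have pq: "p \<in> ?G" "q \<in> ?G" "p \<noteq> q"
    using corners less by (auto simp: special_corner_def special_corner_of_angle_def)
  have "\<forall>\<^sub>F \<theta> in nhds \<theta>\<^sub>0. \<forall>v\<in>?G - {p}. 0 < (along \<theta>\<^sub>0 q - along \<theta>\<^sub>0 p) * (along \<theta> v - along \<theta> p)"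
    by (rule special_corner_strict_extreme) (use \<gamma> corners pq level in auto)
  then have left: "\<forall>\<^sub>F \<theta> in nhds \<theta>\<^sub>0. \<forall>v\<in>?G - {p}. along \<theta> p < along \<theta> v"
    by eventually_elim (use less in \<open>auto simp: zero_less_mult_iff\<close>)
  have "\<forall>\<^sub>F \<theta> in nhds \<theta>\<^sub>0. \<forall>v\<in>?G - {q}. 0 < (along \<theta>\<^sub>0 p - along \<theta>\<^sub>0 q) * (along \<theta> v - along \<theta> q)"
    by (rule special_corner_strict_extreme) (use \<gamma> corners pq level in auto)
  then have right: "\<forall>\<^sub>F \<theta> in nhds \<theta>\<^sub>0. \<forall>v\<in>?G - {q}. along \<theta> v < along \<theta> q"
    by eventually_elim (use less in \<open>auto simp: zero_less_mult_iff\<close>)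
  obtain g where g: "simple_path g" "path_image g = ?G" "pathstart g = p" "pathfinish g = p"
    using jordan_curve_loop[OF \<gamma> pq(1)] .
  then have loop: "pathfinish g = pathstart g" by simp
  have bounded: "bounded ?G"
    using g compact_simple_path_image compact_imp_bounded by metis
  have cont: "continuous_on (path_image g) (across \<theta>\<^sub>0)"
    by (intro continuous_on_frame continuous_on_const continuous_on_id)
  obtain u d where arcs: "arc u" "arc d" "pathstart u = p" "pathfinish u = q"
      "pathstart d = q" "pathfinish d = p" "path_image u \<inter> path_image d = {p, q}"
      "path_image u \<union> path_image d = ?G"
    using exists_double_arc[OF g(1) loop] g(2) pq by metis
  obtain C E lo hi where CE: "path C" "path E" "path_image C \<subseteq> ?G" "path_image E \<subseteq> ?G"
      "across \<theta>\<^sub>0 (pathstart C) = lo" "across \<theta>\<^sub>0 (pathstart E) = lo"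
      "across \<theta>\<^sub>0 (pathfinish C) = hi" "across \<theta>\<^sub>0 (pathfinish E) = hi"
      "\<And>v. v \<in> ?G \<Longrightarrow> across \<theta>\<^sub>0 v \<in> {lo..hi}"
      "\<And>v. v \<in> path_image C \<Longrightarrow> v \<in> path_image E \<Longrightarrow> v \<notin> {p, q} \<and> across \<theta>\<^sub>0 v \<in> {lo, hi}"
    using level_paths[OF g(1) loop, of p q "across \<theta>\<^sub>0", OF _ _ _ level cont] pq unfolding g(2) by metis
  have "\<forall>\<^sub>F \<theta> in nhds \<theta>\<^sub>0. \<exists>a\<in>?G. \<exists>b\<in>?G. \<exists>c\<in>?G. \<exists>d\<in>?G. rhombus_of_angle \<theta> a b c d"
  proof (rule crossing_chords_stable[of u "reversepath d" C E ?G p q \<theta>\<^sub>0 lo hi])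
    show "path_image u \<subseteq> ?G" "path_image (reversepath d) \<subseteq> ?G"
      using arcs(8) by auto
  qed (use arcs CE left right bounded in \<open>auto simp: arc_imp_path\<close>)
  then show ?thesis
  proof eventually_elim
    case (elim \<theta>)
    then obtain a b c d where "{a, b, c, d} \<subseteq> ?G" "rhombus_of_angle \<theta> a b c d"
      by auto
    then show ?case
      unfolding inscribed_rhombus_of_angle_def by blast
  qed
qed

theorem proposition1p8:
  fixes \<gamma> :: "complex \<Rightarrow> real^2" and p q :: "real^2" and \<theta>\<^sub>0 :: real
  assumes "jordan_curve \<gamma>"
    and "special_corner \<gamma> p" and "special_corner \<gamma> q" and "p \<noteq> q"
    and "line_of_angle \<theta>\<^sub>0 (affine hull {p, q})"
  shows "\<exists>\<epsilon>>0. \<forall>\<theta>\<in>{\<theta>\<^sub>0 - \<epsilon><..<\<theta>\<^sub>0 + \<epsilon>}. \<exists>S. inscribed_rhombus_of_angle \<gamma> \<theta> S"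
proof -
  obtain c where "affine hull {p, q} = {v. across \<theta>\<^sub>0 v = c}"
    using assms(5) unfolding line_of_angle_across by (rule exE)
  moreover have "p \<in> affine hull {p, q}" "q \<in> affine hull {p, q}"
    by (simp_all add: hull_inc)
  ultimately have level: "across \<theta>\<^sub>0 p = across \<theta>\<^sub>0 q"
    by auto
  then have "along \<theta>\<^sub>0 p \<noteq> along \<theta>\<^sub>0 q"
    using frame_eqI assms(4) by blast
  then have "\<forall>\<^sub>F \<theta> in nhds \<theta>\<^sub>0. \<exists>S. inscribed_rhombus_of_angle \<gamma> \<theta> S"
    using eventually_inscribed_rhombus[OF assms(1-3) level]
      eventually_inscribed_rhombus[OF assms(1,3,2) level[symmetric]]
    by (auto simp: linorder_neq_iff)
  then obtain \<epsilon> where "\<epsilon> > 0" "\<And>\<theta>. dist \<theta> \<theta>\<^sub>0 < \<epsilon> \<Longrightarrow> \<exists>S. inscribed_rhombus_of_angle \<gamma> \<theta> S"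
    unfolding eventually_nhds_metric by blast
  then show ?thesis
    by (intro exI[of _ \<epsilon>]) (auto simp: dist_real_def abs_less_iff)
qed

end
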